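(* Let $f\in\mathbb{C}[x_1,\overline{x_1},\dots,x_n,\overline{x_n}]$ be a polynomial defined on $\mathbb{T}^n$, regarded modulo the ideal $I$ generated by $x_i\overline{x_i}-1$, $i=1,\dots,n$. Let $G=\mathbb{Z}_{k_1}\times\mathbb{Z}_{k_2}\times\cdots\times\mathbb{Z}_{k_n}$, let $f|_G$ be the restriction of $f$ to $G$, and let $S$ be a subset of $\widehat{G}$. Suppose the following conditions are satisfied: 1. for all $i=1,\dots,n$, $k_i>4\deg_{x_i}(f)$; 2. $f|_G=\sum_{j=1}^m|h_j|^2$ is an FSOS on the group $G$ with $\bigcup_{j=1}^m\operatorname{supp}(h_j)\subseteq S$; 3. for all $\chi_\alpha\in S$ and all $i=1,\dots,n$, either $0\le\alpha_i<\frac{k_i}{4}$ or $k_i\geq\alpha_i>\frac{3k_i}{4}$. Then the functions $\{h_j\}_{j=1}^m$ can be lifted to give an SOHS (sum of Hermitian squares) of $f$ on $\mathbb{T}^n$, namely $$f=\sum_{j=1}^m \mathrm{L}(h_j)\,\overline{\mathrm{L}(h_j)}\quad\text{in }\mathbb{C}[x_1,\overline{x_1},\dots,x_n,\overline{x_n}]/I .$$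
   Context: $\mathbb{T}^n$ is the $n$-fold product of the complex unit circle. In $R=\mathbb{C}[x_1,\overline{x_1},\dots,x_n,\overline{x_n}]/I$, $\overline{x_i}=x_i^{-1}$, and complex conjugation acts on $R$ by conjugating coefficients and exchanging $x_i$ and $\overline{x_i}$. Each $f\in R$ is represented by $f=\sum_{\alpha,\beta\in\mathbb{N}^n}a_{\alpha,\beta}\prod_{i=1}^n x_i^{\alpha_i}\overline{x_i}^{\beta_i}$ in which no monomial contains both $x_i$ and $\overline{x_i}$; a polynomial $f$ and its class in $R$ are not distinguished. With respect to this representation, $\deg_{x_i}(f)$ is the maximal degree of $x_i$ and $\overline{x_i}$ occurring in $f$. Let $[k]=\{0,1,\dots,k-1\}$. For $G=\mathbb{Z}_{k_1}\times\cdots\times\mathbb{Z}_{k_n}$ and $\alpha\in[k_1]\times\cdots\times[k_n]$, $\chi_\alpha$ is the character $\chi_\alpha(y_1,\dots,y_n)=\prod_{i=1}^n e^{2\pi\sqrt{-1}\,\alpha_iy_i/k_i}$; these are all elements of the character group $\widehat{G}$. The restriction of $f$ to $G$ is the function $f|_G(y_1,\dots,y_n)=\sum_{\alpha,\beta}a_{\alpha,\beta}\prod_{i=1}^n e^{2\pi\sqrt{-1}(\alpha_i-\beta_i)y_i/k_i}$. For $g:G\to\mathbb{C}$ with Fourier expansion $g=\sum_\alpha a_\alpha\chi_\alpha$, $\operatorname{supp}(g)=\{\chi_\alpha:a_\alpha\neq0\}$, and the lift of $g$ is $\mathrm{L}(g)=\sum_{\alpha}a_\alpha\prod_{i=1}^n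 x_i^{\tau_{k_i}(\alpha_i)}\in R$, where $\tau_{k}(j)=j$ if $j<k/2$, $\tau_k(j)=j-k$ if $j\ge k/2$, and $x_i^{-j}=\overline{x_i}^{\,j}$. An FSOS on $G$ is an expression of a function as a finite sum $\sum_j|h_j|^2$ of functions $h_j:G\to\mathbb{C}$. An SOHS of $f$ on $\mathbb{T}^n$ is an expression $f=\sum_j g_j\overline{g_j}$ in $R$ (so that $f(x)=\sum_j|g_j(x)|^2$ on $\mathbb{T}^n$). *)

theory Defs
  imports
    "HOL-Algebra.Product_Groups"
    "HOL-Library.Poly_Mapping"
    Complex_Main
begin

section \<open>Polynomial functions on the torus\<close>

text \<open>
  The finite index type \<open>'n\<close> plays the role of \<open>{1,...,n}\<close>. Polynomials in the \<open>2n\<close> independent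
  variables \<open>x i\<close> (\<open>X i\<close>) and \<open>x i\<close>-bar (\<open>Xbar i\<close>) are finitely supported
  coefficient functions on monomials, with the convolution product of \<open>Poly_Mapping\<close>.
\<close>

datatype 'n torus_var = X 'n | Xbar 'n

type_synonym 'n monomial = "'n torus_var \<Rightarrow>\<^sub>0 nat"

type_synonym 'n torus_poly = "'n monomial \<Rightarrow>\<^sub>0 complex"

definition const :: "complex \<Rightarrow> 'n torus_poly" where
  "const c = Poly_Mapping.single 0 c"

definition var :: "'n torus_var \<Rightarrow> 'n torus_poly" where
  "var v = Poly_Mapping.single (Poly_Mapping.single v 1) 1"

text \<open>The span of a subset of a ring, viewed as a module over itself, is the ideal it generates.\<close>

definition torus_ideal :: "'n torus_poly set" where
  "torus_ideal = Modules.module.span (*) (range (\<lambda>i. var (X i) * var (Xbar i) - 1))"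

definition torus_cong :: "'n torus_poly \<Rightarrow> 'n torus_poly \<Rightarrow> bool" where
  "torus_cong f g \<longleftrightarrow> f - g \<in> torus_ideal"

definition reduced :: "'n torus_poly \<Rightarrow> bool" where
  "reduced r \<longleftrightarrow> (\<forall>m \<in> Poly_Mapping.keys r. \<forall>i.
     Poly_Mapping.lookup m (X i) = 0 \<or> Poly_Mapping.lookup m (Xbar i) = 0)"

text \<open>The unique reduced representative, see \<open>ex1_reduced\<close> below.\<close>

definition torus_rep :: "'n torus_poly \<Rightarrow> 'n torus_poly" where
  "torus_rep f = (THE r. reduced r \<and> torus_cong f r)"

text \<open>The zero polynomial has degree 0 here.\<close>

definition torus_deg :: "'n \<Rightarrow> 'n torus_poly \<Rightarrow> nat" where
  "torus_deg i f = Max (insert 0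
     ((\<lambda>m. max (Poly_Mapping.lookup m (X i)) (Poly_Mapping.lookup m (Xbar i)))
        ` Poly_Mapping.keys (torus_rep f)))"

fun swap_var :: "'n torus_var \<Rightarrow> 'n torus_var" where
  "swap_var (X i) = Xbar i"
| "swap_var (Xbar i) = X i"

definition conj_poly :: "'n torus_poly \<Rightarrow> 'n torus_poly" where
  "conj_poly f = (\<Sum>m \<in> Poly_Mapping.keys f.
     Poly_Mapping.single (Poly_Mapping.map_key swap_var m) (cnj (Poly_Mapping.lookup f m)))"


section \<open>Fourier analysis on a product of cyclic groups\<close>

text \<open>If all \<open>k i > 0\<close>, the elements are the functions \<open>y\<close> with \<open>0 \<le> y i < k i\<close>.\<close>

definition cyclic_product :: "('n \<Rightarrow> nat) \<Rightarrow> ('n \<Rightarrow> int) monoid" where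
  "cyclic_product k = product_group UNIV (\<lambda>i. integer_mod_group (k i))"

abbreviation complex_units :: "complex monoid" where
  "complex_units \<equiv> \<lparr>carrier = - {0}, monoid.mult = (*), one = 1\<rparr>"

text \<open>
  Characters are homomorphisms on the carrier; they are made \<open>undefined\<close> outside of it, so that
  equality of characters is equality on the group.
\<close>

definition character_group :: "('a, 'b) monoid_scheme \<Rightarrow> ('a \<Rightarrow> complex) set" where
  "character_group G = hom G complex_units \<inter> extensional (carrier G)"

definition char_indices :: "('n \<Rightarrow> nat) \<Rightarrow> ('n \<Rightarrow> nat) set" where
  "char_indices k = {\<alpha>. \<forall>i. \<alpha> i < k i}"

definition chi :: "('n::finite \<Rightarrow> nat) \<Rightarrow> ('n \<Rightarrow> nat) \<Rightarrow> ('n \<Rightarrow> int) \<Rightarrow> complex" where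
  "chi k \<alpha> = (\<lambda>y \<in> carrier (cyclic_product k).
     \<Prod>i\<in>UNIV. exp (2 * of_real pi * \<i> * of_nat (\<alpha> i) * of_int (y i) / of_nat (k i)))"

text \<open>
  These are the coefficients of the Fourier expansion of \<open>g\<close>, see \<open>fourier_expansion\<close> and
  \<open>fourier_coeff_unique\<close> below.
\<close>

definition fourier_coeff ::
  "('n::finite \<Rightarrow> nat) \<Rightarrow> (('n \<Rightarrow> int) \<Rightarrow> complex) \<Rightarrow> ('n \<Rightarrow> nat) \<Rightarrow> complex" where
  "fourier_coeff k g \<alpha> =
     (\<Sum>y \<in> carrier (cyclic_product k). g y * cnj (chi k \<alpha> y)) / of_nat (card (carrier (cyclic_product k)))"

definition fourier_supp ::
  "('n::finite \<Rightarrow> nat) \<Rightarrow> (('n \<Rightarrow> int) \<Rightarrow> complex) \<Rightarrow> (('n \<Rightarrow> int) \<Rightarrow> complex) set" where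
  "fourier_supp k g = {chi k \<alpha> | \<alpha>. \<alpha> \<in> char_indices k \<and> fourier_coeff k g \<alpha> \<noteq> 0}"

text \<open>
  The value does not depend on the representative of \<open>f\<close> modulo the torus ideal, see
  \<open>restriction_cong\<close> below.
\<close>

definition restriction ::
  "('n::finite \<Rightarrow> nat) \<Rightarrow> 'n torus_poly \<Rightarrow> ('n \<Rightarrow> int) \<Rightarrow> complex" where
  "restriction k f y = (\<Sum>m \<in> Poly_Mapping.keys f. Poly_Mapping.lookup f m *
     (\<Prod>i\<in>UNIV. exp (2 * of_real pi * \<i>
        * (of_nat (Poly_Mapping.lookup m (X i)) - of_nat (Poly_Mapping.lookup m (Xbar i)))
        * of_int (y i) / of_nat (k i))))"

definition tau :: "nat \<Rightarrow> nat \<Rightarrow> int" where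
  "tau k j = (if real j < real k / 2 then int j else int j - int k)"

definition var_power :: "'n \<Rightarrow> int \<Rightarrow> 'n torus_poly" where
  "var_power i e = (if e \<ge> 0 then var (X i) ^ nat e else var (Xbar i) ^ nat (- e))"

definition lift ::
  "('n::finite \<Rightarrow> nat) \<Rightarrow> (('n \<Rightarrow> int) \<Rightarrow> complex) \<Rightarrow> 'n torus_poly" where
  "lift k g = (\<Sum>\<alpha> \<in> char_indices k.
     const (fourier_coeff k g \<alpha>) * (\<Prod>i\<in>UNIV. var_power i (tau (k i) (\<alpha> i))))"

section \<open>Well-definedness\<close>

lemma module_torus: "Modules.module ((*) :: 'n torus_poly \<Rightarrow> _)"
  by unfold_locales (simp_all add: algebra_simps)

text \<open>
  A weight on monomials that is invariant under multiplication by \<open>x i\<close> times \<open>x i\<close>-bar extends to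
  a linear functional vanishing on the ideal (\<open>wsum_ideal\<close>).
\<close>

definition wsum :: "('n monomial \<Rightarrow> complex) \<Rightarrow> 'n torus_poly \<Rightarrow> complex" where
  "wsum w p = (\<Sum>m \<in> Poly_Mapping.keys p. Poly_Mapping.lookup p m * w m)"

lemma wsum_zero: "wsum w 0 = 0"
  by (simp add: wsum_def)

lemma wsum_add: "wsum w (p + q) = wsum w p + wsum w q"
  unfolding wsum_def
  by (rule setsum_keys_plus_distrib[where f = "\<lambda>k x. x * w k"]) (simp_all add: algebra_simps)

lemma wsum_uminus: "wsum w (- p) = - wsum w p"
  using wsum_add[of w p "- p"] by (simp add: wsum_zero eq_neg_iff_add_eq_0 add.commute)

lemma wsum_diff: "wsum w (p - q) = wsum w p - wsum w q"
  using wsum_add[of w p "- q"] by (simp add: wsum_uminus)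

lemma wsum_single: "wsum w (Poly_Mapping.single m c) = c * w m"
  by (simp add: wsum_def)

lemma torus_poly_induct [case_names zero add]:
  fixes p :: "'n torus_poly"
  assumes "P 0" "\<And>p m c. P p \<Longrightarrow> P (p + Poly_Mapping.single m c)"
  shows "P p"
proof (induction p rule: Poly_Mapping.update_induct)
  case const
  show ?case by (fact assms(1))
next
  case (update f a b)
  have "Poly_Mapping.update a b f = f + Poly_Mapping.single a b"
    using update.hyps(1)
    by (intro poly_mapping_eqI)
       (auto simp: lookup_update lookup_add lookup_single when_def in_keys_iff)
  then show ?case using assms(2) update by metis
qed

definition pair_mono :: "'n \<Rightarrow> 'n monomial" where
  "pair_mono i = Poly_Mapping.single (X i) 1 + Poly_Mapping.single (Xbar i) 1"

lemma var_pair: "var (X i) * var (Xbar i) = Poly_Mapping.single (pair_mono i) 1"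
  by (simp add: var_def pair_mono_def mult_single)

lemma wsum_ideal:
  assumes w: "\<And>m i. w (m + pair_mono i) = w m" and p: "p \<in> torus_ideal"
  shows "wsum w p = 0"
proof -
  have gen: "wsum w (q * (var (X i) * var (Xbar i) - 1)) = 0" for q i
  proof (induction q rule: torus_poly_induct)
    case zero
    show ?case by (simp add: wsum_zero)
  next
    case (add q m c)
    have "Poly_Mapping.single m c * (var (X i) * var (Xbar i) - 1)
        = Poly_Mapping.single (m + pair_mono i) c - Poly_Mapping.single m c"
      by (simp add: var_pair right_diff_distrib mult_single)
    then show ?case
      using add by (simp add: distrib_right wsum_add wsum_diff wsum_single w)
  qed
  interpret M: Modules.module "(*) :: 'a torus_poly \<Rightarrow> _" by (rule module_torus)
  from p show ?thesis
    unfolding torus_ideal_def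
    by (induction rule: M.span_induct_alt) (auto simp: wsum_zero wsum_add gen)
qed

lemma torus_cong_refl: "torus_cong f f"
proof -
  interpret M: Modules.module "(*) :: 'a torus_poly \<Rightarrow> _" by (rule module_torus)
  show ?thesis by (simp add: torus_cong_def torus_ideal_def M.span_zero)
qed

lemma torus_cong_trans:
  assumes "torus_cong f g" "torus_cong g h" shows "torus_cong f h"
proof -
  interpret M: Modules.module "(*) :: 'a torus_poly \<Rightarrow> _" by (rule module_torus)
  show ?thesis using M.span_add[OF assms[unfolded torus_cong_def torus_ideal_def]]
    by (simp add: torus_cong_def torus_ideal_def)
qed

lemma torus_cong_sym:
  assumes "torus_cong f g" shows "torus_cong g f"
proof -
  interpret M: Modules.module "(*) :: 'a torus_poly \<Rightarrow> _" by (rule module_torus)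
  show ?thesis using M.span_neg[OF assms[unfolded torus_cong_def torus_ideal_def]]
    by (simp add: torus_cong_def torus_ideal_def)
qed

lemma torus_cong_add:
  assumes "torus_cong f g" "torus_cong f' g'" shows "torus_cong (f + f') (g + g')"
proof -
  interpret M: Modules.module "(*) :: 'a torus_poly \<Rightarrow> _" by (rule module_torus)
  have "f + f' - (g + g') = (f - g) + (f' - g')" by simp
  then show ?thesis using M.span_add[OF assms[unfolded torus_cong_def torus_ideal_def]]
    by (simp only: torus_cong_def torus_ideal_def)
qed

lemma torus_cong_pair:
  "torus_cong (Poly_Mapping.single (m + pair_mono i) c) (Poly_Mapping.single m c)"
proof -
  interpret M: Modules.module "(*) :: 'a torus_poly \<Rightarrow> _" by (rule module_torus)
  have "Poly_Mapping.single (m + pair_mono i) c - Poly_Mapping.single m c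
      = Poly_Mapping.single m c * (var (X i) * var (Xbar i) - 1)"
    by (simp add: var_pair right_diff_distrib mult_single)
  moreover have "\<dots> \<in> torus_ideal"
    unfolding torus_ideal_def by (intro M.span_scale M.span_base) auto
  ultimately show ?thesis by (simp add: torus_cong_def)
qed

lemma ex_reduced_monomial:
  fixes m :: "'n::finite monomial"
  shows "\<exists>m'. reduced (Poly_Mapping.single m' c) \<and>
    torus_cong (Poly_Mapping.single m c) (Poly_Mapping.single m' c)"
proof (induction "\<Sum>i\<in>UNIV. Poly_Mapping.lookup m (X i)" arbitrary: m rule: less_induct)
  case less
  show ?case
  proof (cases "reduced (Poly_Mapping.single m c)")
    case True
    then show ?thesis using torus_cong_refl by blast
  next
    case False
    then obtain i where i: "Poly_Mapping.lookup m (X i) > 0" "Poly_Mapping.lookup m (Xbar i) > 0"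
      by (auto simp: reduced_def split: if_splits)
    define m' where "m' = m - pair_mono i"
    have m: "m = m' + pair_mono i"
      using i by (intro poly_mapping_eqI)
        (auto simp: m'_def pair_mono_def lookup_add lookup_minus lookup_single when_def)
    have "(\<Sum>j\<in>UNIV. Poly_Mapping.lookup m' (X j)) < (\<Sum>j\<in>UNIV. Poly_Mapping.lookup m (X j))"
      by (rule sum_strict_mono_ex1)
         (auto simp: m pair_mono_def lookup_add lookup_single when_def)
    from less[OF this] show ?thesis
      using torus_cong_pair[of m' i c] torus_cong_trans unfolding m by blast
  qed
qed

lemma reduced_add:
  assumes "reduced p" "reduced q" shows "reduced (p + q)"
  unfolding reduced_def
proof
  fix m assume "m \<in> Poly_Mapping.keys (p + q)"
  then have "m \<in> Poly_Mapping.keys p \<or> m \<in> Poly_Mapping.keys q"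
    using keys_add[of p q] by auto
  then show "\<forall>i. Poly_Mapping.lookup m (X i) = 0 \<or> Poly_Mapping.lookup m (Xbar i) = 0"
    by (elim disjE) (rule bspec[OF assms(1)[unfolded reduced_def]], assumption,
        rule bspec[OF assms(2)[unfolded reduced_def]], assumption)
qed

lemma reduced_cong_unique:
  fixes r r' :: "'a torus_poly"
  assumes r: "reduced r" "reduced r'" and c: "torus_cong r r'"
  shows "r = r'"
proof (rule poly_mapping_eqI)
  define d where "d m i = int (Poly_Mapping.lookup m (X i)) - int (Poly_Mapping.lookup m (Xbar i))"
    for m :: "'a monomial" and i
  define is_red where "is_red m \<longleftrightarrow> (\<forall>i. Poly_Mapping.lookup m (X i) = 0 \<or> Poly_Mapping.lookup m (Xbar i) = 0)"
    for m :: "'a monomial"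
  have inj: "m = m'" if "is_red m" "is_red m'" "d m = d m'" for m m'
  proof (rule poly_mapping_eqI)
    fix v :: "'a torus_var"
    obtain i where v: "v = X i \<or> v = Xbar i" by (cases v) auto
    have "d m i = d m' i" using that by simp
    then show "Poly_Mapping.lookup m v = Poly_Mapping.lookup m' v"
      using that(1,2)[unfolded is_red_def, rule_format, of i] v by (auto simp: d_def)
  qed
  have red_wsum: "wsum (\<lambda>m'. if d m' = d m then 1 else 0) p = Poly_Mapping.lookup p m"
    if "reduced p" "is_red m" for p m
  proof -
    have "wsum (\<lambda>m'. if d m' = d m then 1 else 0) p =
        (\<Sum>m' \<in> Poly_Mapping.keys p. if m' = m then Poly_Mapping.lookup p m' else 0)"
      unfolding wsum_def using that inj
      by (intro sum.cong) (auto simp: reduced_def is_red_def)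
    then show ?thesis by (simp add: in_keys_iff)
  qed
  fix m
  show "Poly_Mapping.lookup r m = Poly_Mapping.lookup r' m"
  proof (cases "is_red m")
    case True
    have "wsum (\<lambda>m'. if d m' = d m then 1 else 0) (r - r') = 0"
      using c unfolding torus_cong_def
      by (intro wsum_ideal)
         (auto simp: d_def fun_eq_iff pair_mono_def lookup_add lookup_single when_def)
    then show ?thesis using red_wsum r True by (simp add: wsum_diff)
  next
    case False
    then have "m \<notin> Poly_Mapping.keys r" "m \<notin> Poly_Mapping.keys r'"
      using bspec[OF r(1)[unfolded reduced_def], of m] bspec[OF r(2)[unfolded reduced_def], of m]
      unfolding is_red_def by argo+
    then show ?thesis by (simp add: in_keys_iff)
  qed
qed

lemma ex1_reduced:
  fixes f :: "'n::finite torus_poly"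
  shows "\<exists>!r. reduced r \<and> torus_cong f r"
proof -
  have "\<exists>r. reduced r \<and> torus_cong f r"
  proof (induction f rule: torus_poly_induct)
    case zero
    show ?case by (rule exI[of _ 0]) (simp add: reduced_def torus_cong_refl)
  next
    case (add p m c)
    then show ?case
      using ex_reduced_monomial[of c m] reduced_add torus_cong_add by metis
  qed
  then show ?thesis
    using reduced_cong_unique torus_cong_sym torus_cong_trans by metis
qed

lemma torus_rep: "reduced (torus_rep f)" "torus_cong f (torus_rep f)"
  for f :: "'n::finite torus_poly"
  using theI'[OF ex1_reduced[of f]] unfolding torus_rep_def by auto

lemma restriction_cong:
  assumes "torus_cong f g"
  shows "restriction k f y = restriction k g y"
proof -
  let ?w = "\<lambda>m::'a monomial. (\<Prod>i\<in>UNIV. exp (2 * of_real pi * \<i>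
        * (of_nat (Poly_Mapping.lookup m (X i)) - of_nat (Poly_Mapping.lookup m (Xbar i)))
        * of_int (y i) / of_nat (k i)))"
  have "wsum ?w (f - g) = 0"
    using assms unfolding torus_cong_def
    by (intro wsum_ideal prod.cong)
       (auto simp: pair_mono_def lookup_add lookup_single when_def)
  then show ?thesis by (simp add: wsum_diff) (simp add: wsum_def restriction_def)
qed

lemma inj_swap_var: "inj swap_var"
proof (rule injI)
  fix a b :: "'n torus_var"
  show "swap_var a = swap_var b \<Longrightarrow> a = b" by (cases a; cases b) auto
qed

lemma conj_poly_monomial:
  "conj_poly (Poly_Mapping.single m c) = Poly_Mapping.single (Poly_Mapping.map_key swap_var m) (cnj c)"
  by (simp add: conj_poly_def)

lemma conj_poly_var:
  "conj_poly (var (X i)) = var (Xbar i)" "conj_poly (var (Xbar i)) = var (X i)"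
  using map_key_single[OF inj_swap_var, of "Xbar i" "1::nat"]
    map_key_single[OF inj_swap_var, of "X i" "1::nat"]
  by (simp_all add: var_def conj_poly_monomial)

lemma carrier_cyclic_product:
  assumes "\<forall>i. k i > 0"
  shows "carrier (cyclic_product k) = (\<Pi>\<^sub>E i\<in>UNIV. {0..<int (k i)})"
  using assms unfolding cyclic_product_def carrier_product_group
  by (intro PiE_cong) (simp add: carrier_integer_mod_group)

lemma char_indices_PiE: "char_indices k = (\<Pi>\<^sub>E i\<in>UNIV. {..<k i})"
  by (auto simp: char_indices_def PiE_def Pi_def)

lemma finite_char_indices: "finite (char_indices (k :: 'n::finite \<Rightarrow> nat))"
  by (simp add: char_indices_PiE finite_PiE)

lemma root_sum:
  assumes k: "k > 0" and d: "\<bar>d\<bar> < int k"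
  shows "(\<Sum>a<k. exp (2 * of_real pi * \<i> * of_nat a * of_int d / of_nat k)) =
    (if d = 0 then of_nat k else (0::complex))"
proof (cases "d = 0")
  case True
  then show ?thesis by simp
next
  case False
  define z where "z = exp (2 * of_real pi * \<i> * of_int d / of_nat k)"
  have pow: "exp (2 * of_real pi * \<i> * of_nat a * of_int d / of_nat k) = z ^ a" for a
    by (simp add: z_def exp_of_nat_mult [symmetric] algebra_simps)
  have "z ^ k = exp (of_nat k * (2 * of_real pi * \<i> * of_int d / of_nat k))"
    by (simp only: z_def exp_of_nat_mult)
  also have "\<dots> = cis (2 * pi * real_of_int d)"
    using k by (simp add: cis_conv_exp mult_ac)
  also have "\<dots> = 1"
    by (rule cis_multiple_2pi) auto
  finally have zk: "z ^ k = 1" .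
  have "z \<noteq> 1"
  proof
    assume "z = 1"
    moreover have "z = cis (2 * pi * real_of_int d / real k)"
      by (simp add: z_def cis_conv_exp mult_ac)
    ultimately have "cos (2 * pi * real_of_int d / real k) = 1"
      by (metis cis.sel(1) one_complex.sel(1))
    then obtain n :: int where "2 * pi * real_of_int d / real k = of_int n * 2 * pi"
      by (auto simp: cos_one_2pi_int)
    then have "real_of_int d = real_of_int (n * int k)"
      using k by (simp add: field_simps)
    then have "d = n * int k" by (simp only: of_int_eq_iff)
    then have "int k dvd d" by simp
    with False d show False using dvd_imp_le_int by force
  qed
  then show ?thesis using False zk by (simp add: pow geometric_sum)
qed

lemma root_sum_int:
  assumes k: "k > 0" and d: "\<bar>d\<bar> < int k"
  shows "(\<Sum>a\<in>{0..<int k}. exp (2 * of_real pi * \<i> * of_int a * of_int d / of_nat k)) =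
    (if d = 0 then of_nat k else (0::complex))"
proof -
  have "(\<Sum>a\<in>{0..<int k}. exp (2 * of_real pi * \<i> * of_int a * of_int d / of_nat k)) =
      (\<Sum>a<k. exp (2 * of_real pi * \<i> * of_nat a * of_int d / of_nat k))"
    by (rule sum.reindex_bij_witness[of _ int nat]) auto
  then show ?thesis using root_sum[OF assms] by simp
qed

lemma exp_cnj_mult:
  "exp (2 * of_real pi * \<i> * of_nat a * of_int y / of_nat k) *
     cnj (exp (2 * of_real pi * \<i> * of_nat b * of_int z / of_nat k)) =
   exp (2 * of_real pi * \<i> * of_int (int a * y - int b * z) / of_nat k)"
proof -
  have e: "exp (2 * of_real pi * \<i> * of_nat a * of_int y / of_nat k) = cis (2 * pi * a * y / k)"
    for a :: nat and y :: int
    by (simp add: cis_conv_exp mult_ac)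
  have "exp (2 * of_real pi * \<i> * of_int (int a * y - int b * z) / of_nat k)
      = cis (2 * pi * a * y / k + - (2 * pi * b * z / k))"
    by (simp add: cis_conv_exp algebra_simps diff_divide_distrib)
  then show ?thesis
    by (simp only: e cis_cnj cis_mult)
qed

lemma chi_cnj:
  assumes "y \<in> carrier (cyclic_product k)" "z \<in> carrier (cyclic_product k)"
  shows "chi k \<alpha> y * cnj (chi k \<beta> z) =
    (\<Prod>i\<in>UNIV. exp (2 * of_real pi * \<i> * of_int (int (\<alpha> i) * y i - int (\<beta> i) * z i) / of_nat (k i)))"
  using assms
  by (simp add: chi_def prod.distrib [symmetric] exp_cnj_mult del: of_int_diff of_int_mult)

lemma finite_carrier_cyclic_product:
  assumes "\<forall>i. k i > 0"
  shows "finite (carrier (cyclic_product (k :: 'n::finite \<Rightarrow> nat)))"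
  by (simp add: carrier_cyclic_product[OF assms] finite_PiE)

lemma card_carrier_cyclic_product:
  assumes "\<forall>i. k i > 0"
  shows "card (carrier (cyclic_product (k :: 'n::finite \<Rightarrow> nat))) = (\<Prod>i\<in>UNIV. k i)"
  by (simp add: carrier_cyclic_product[OF assms] card_PiE)

lemma prod_if_all:
  "(\<Prod>i\<in>(UNIV::'n::finite set). if P i then of_nat (k i) else (0::complex)) =
    (if \<forall>i. P i then of_nat (\<Prod>i\<in>UNIV. k i) else 0)"
  by (auto intro: prod_zero)

lemma chi_orthogonal:
  fixes k :: "'n::finite \<Rightarrow> nat"
  assumes k: "\<forall>i. k i > 0" and y: "y \<in> carrier (cyclic_product k)" "z \<in> carrier (cyclic_product k)"
  shows "(\<Sum>\<alpha>\<in>char_indices k. chi k \<alpha> y * cnj (chi k \<alpha> z)) =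
    (if y = z then of_nat (card (carrier (cyclic_product k))) else 0)"
proof -
  have b: "0 \<le> y i" "y i < int (k i)" "0 \<le> z i" "z i < int (k i)" for i
    using y unfolding carrier_cyclic_product[OF k] by (auto simp: PiE_iff)
  have "(\<Sum>\<alpha>\<in>char_indices k. chi k \<alpha> y * cnj (chi k \<alpha> z)) =
      (\<Sum>\<alpha>\<in>char_indices k. \<Prod>i\<in>UNIV.
        exp (2 * of_real pi * \<i> * of_nat (\<alpha> i) * of_int (y i - z i) / of_nat (k i)))"
    using y by (intro sum.cong prod.cong refl) (simp_all add: chi_cnj algebra_simps)
  also have "\<dots> = (\<Prod>i\<in>UNIV. \<Sum>a<k i.
        exp (2 * of_real pi * \<i> * of_nat a * of_int (y i - z i) / of_nat (k i)))"
    unfolding char_indices_PiE by (rule prod_sum_PiE [symmetric]) auto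
  also have "\<dots> = (\<Prod>i\<in>UNIV. if y i = z i then of_nat (k i) else 0)"
  proof (rule prod.cong)
    fix i
    have "\<bar>y i - z i\<bar> < int (k i)" using b[of i] by linarith
    then show "(\<Sum>a<k i. exp (2 * of_real pi * \<i> * of_nat a * of_int (y i - z i) / of_nat (k i)))
        = (if y i = z i then of_nat (k i) else 0)"
      using root_sum[of "k i" "y i - z i"] k by simp
  qed simp
  finally show ?thesis
    by (simp add: prod_if_all card_carrier_cyclic_product[OF k] fun_eq_iff del: of_nat_prod)
qed

lemma chi_orthogonal':
  fixes k :: "'n::finite \<Rightarrow> nat"
  assumes k: "\<forall>i. k i > 0" and \<alpha>: "\<alpha> \<in> char_indices k" "\<beta> \<in> char_indices k"
  shows "(\<Sum>y\<in>carrier (cyclic_product k). chi k \<alpha> y * cnj (chi k \<beta> y)) =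
    (if \<alpha> = \<beta> then of_nat (card (carrier (cyclic_product k))) else 0)"
proof -
  have "(\<Sum>y\<in>carrier (cyclic_product k). chi k \<alpha> y * cnj (chi k \<beta> y)) =
      (\<Sum>y\<in>carrier (cyclic_product k). \<Prod>i\<in>UNIV.
        exp (2 * of_real pi * \<i> * of_int (y i) * of_int (int (\<alpha> i) - int (\<beta> i)) / of_nat (k i)))"
    by (intro sum.cong prod.cong refl) (simp_all add: chi_cnj algebra_simps)
  also have "\<dots> = (\<Prod>i\<in>UNIV. \<Sum>y\<in>{0..<int (k i)}.
        exp (2 * of_real pi * \<i> * of_int y * of_int (int (\<alpha> i) - int (\<beta> i)) / of_nat (k i)))"
    unfolding carrier_cyclic_product[OF k] by (rule prod_sum_PiE [symmetric]) auto
  also have "\<dots> = (\<Prod>i\<in>UNIV. if \<alpha> i = \<beta> i then of_nat (k i) else 0)"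
  proof (rule prod.cong)
    fix i
    have "\<alpha> i < k i" "\<beta> i < k i" using \<alpha> by (auto simp: char_indices_def)
    then have "\<bar>int (\<alpha> i) - int (\<beta> i)\<bar> < int (k i)" by linarith
    then show "(\<Sum>y\<in>{0..<int (k i)}.
        exp (2 * of_real pi * \<i> * of_int y * of_int (int (\<alpha> i) - int (\<beta> i)) / of_nat (k i)))
        = (if \<alpha> i = \<beta> i then of_nat (k i) else 0)"
      using root_sum_int[of "k i" "int (\<alpha> i) - int (\<beta> i)"] k by simp
  qed simp
  finally show ?thesis
    by (simp add: prod_if_all card_carrier_cyclic_product[OF k] fun_eq_iff del: of_nat_prod)
qed

lemma card_carrier_pos:
  assumes "\<forall>i. k i > 0"
  shows "card (carrier (cyclic_product (k :: 'n::finite \<Rightarrow> nat))) > 0"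
  using assms by (simp add: card_carrier_cyclic_product prod_pos)

lemma fourier_expansion:
  assumes k: "\<forall>i. k i > 0" and y: "y \<in> carrier (cyclic_product k)"
  shows "g y = (\<Sum>\<alpha> \<in> char_indices k. fourier_coeff k g \<alpha> * chi k \<alpha> y)"
proof -
  let ?G = "carrier (cyclic_product k)"
  have "(\<Sum>\<alpha> \<in> char_indices k. fourier_coeff k g \<alpha> * chi k \<alpha> y) =
      (\<Sum>\<alpha> \<in> char_indices k. \<Sum>z \<in> ?G. g z / of_nat (card ?G) * (chi k \<alpha> y * cnj (chi k \<alpha> z)))"
    unfolding fourier_coeff_def sum_divide_distrib sum_distrib_right
    by (intro sum.cong refl) simp
  also have "\<dots> = (\<Sum>z \<in> ?G. g z / of_nat (card ?G) * (\<Sum>\<alpha> \<in> char_indices k. chi k \<alpha> y * cnj (chi k \<alpha> z)))"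
    by (subst sum.swap) (simp add: sum_distrib_left)
  also have "\<dots> = (\<Sum>z \<in> ?G. if y = z then g z else 0)"
    using card_carrier_pos[OF k] by (intro sum.cong refl) (simp add: chi_orthogonal[OF k y])
  also have "\<dots> = g y"
    using y finite_carrier_cyclic_product[OF k] by simp
  finally show ?thesis ..
qed

lemma fourier_coeff_unique:
  assumes k: "\<forall>i. k i > 0"
    and a: "\<And>y. y \<in> carrier (cyclic_product k) \<Longrightarrow> g y = (\<Sum>\<alpha> \<in> char_indices k. a \<alpha> * chi k \<alpha> y)"
    and \<alpha>: "\<alpha> \<in> char_indices k"
  shows "fourier_coeff k g \<alpha> = a \<alpha>"
proof -
  let ?G = "carrier (cyclic_product k)"
  have "(\<Sum>y \<in> ?G. g y * cnj (chi k \<alpha> y)) =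
      (\<Sum>y \<in> ?G. \<Sum>\<beta> \<in> char_indices k. a \<beta> * (chi k \<beta> y * cnj (chi k \<alpha> y)))"
    by (intro sum.cong refl) (simp add: a sum_distrib_right mult.assoc)
  also have "\<dots> = (\<Sum>\<beta> \<in> char_indices k. a \<beta> * (\<Sum>y \<in> ?G. chi k \<beta> y * cnj (chi k \<alpha> y)))"
    by (subst sum.swap) (simp add: sum_distrib_left)
  also have "\<dots> = (\<Sum>\<beta> \<in> char_indices k. if \<beta> = \<alpha> then a \<beta> * of_nat (card ?G) else 0)"
    using \<alpha> by (intro sum.cong refl) (simp add: chi_orthogonal'[OF k])
  also have "\<dots> = a \<alpha> * of_nat (card ?G)"
    using \<alpha> by (simp add: finite_char_indices)
  finally show ?thesis
    using card_carrier_pos[OF k] by (simp add: fourier_coeff_def)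
qed

lemma group_cyclic_product: "group (cyclic_product k)"
  by (simp add: cyclic_product_def)

lemma exp_mod:
  assumes "k > 0"
  shows "exp (2 * of_real pi * \<i> * of_nat a * of_int ((x + y) mod int k) / of_nat k) =
    exp (2 * of_real pi * \<i> * of_nat a * of_int x / of_nat k) *
    exp (2 * of_real pi * \<i> * of_nat a * of_int y / of_nat k)"
proof -
  define q where "q = (x + y) div int k"
  have "x + y = int k * q + (x + y) mod int k"
    by (simp add: q_def)
  then have "(of_int x + of_int y :: complex) = of_nat k * of_int q + of_int ((x + y) mod int k)"
    by (metis of_int_add of_int_mult of_int_of_nat_eq)
  then have "2 * of_real pi * \<i> * of_nat a * of_int x / of_nat k +
      2 * of_real pi * \<i> * of_nat a * of_int y / of_nat k =
      \<i> * of_real (2 * pi * of_int (int a * q)) +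
      2 * of_real pi * \<i> * of_nat a * of_int ((x + y) mod int k) / of_nat k"
    using assms by (simp add: add_divide_distrib [symmetric] distrib_left [symmetric] mult.assoc)
      (simp add: field_simps)
  moreover have "exp (\<i> * of_real (2 * pi * of_int (int a * q))) = 1"
    unfolding cis_conv_exp [symmetric] by (rule cis_multiple_2pi) simp
  ultimately show ?thesis
    by (metis exp_add mult_1)
qed

lemma chi_mult:
  assumes k: "\<forall>i. k i > 0"
    and x: "x \<in> carrier (cyclic_product k)" and y: "y \<in> carrier (cyclic_product k)"
  shows "chi k \<alpha> (x \<otimes>\<^bsub>cyclic_product k\<^esub> y) = chi k \<alpha> x * chi k \<alpha> y"
proof -
  have "x \<otimes>\<^bsub>cyclic_product k\<^esub> y \<in> carrier (cyclic_product k)"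
    using x y group_cyclic_product[of k] by (simp add: group.is_monoid monoid.m_closed)
  then show ?thesis
    using x y k by (simp add: chi_def prod.distrib [symmetric])
      (simp add: cyclic_product_def exp_mod)
qed

lemma chi_norm:
  assumes "y \<in> carrier (cyclic_product k)"
  shows "chi k \<alpha> y * cnj (chi k \<alpha> y) = 1"
  using assms by (simp add: chi_cnj)

lemma character_group_cyclic_product:
  assumes k: "\<forall>i. k i > 0"
  shows "character_group (cyclic_product k) = chi k ` char_indices k"
proof (intro equalityI subsetI)
  fix \<phi> assume "\<phi> \<in> chi k ` char_indices k"
  then obtain \<alpha> where \<phi>: "\<phi> = chi k \<alpha>" by blast
  have "chi k \<alpha> \<in> hom (cyclic_product k) complex_units"
    using chi_norm[of _ k \<alpha>] by (intro homI) (force simp: chi_mult[OF k])+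
  then show "\<phi> \<in> character_group (cyclic_product k)"
    by (simp add: character_group_def \<phi>) (simp add: chi_def)
next
  let ?G = "carrier (cyclic_product k)"
  interpret G: group "cyclic_product k" by (rule group_cyclic_product)
  fix \<phi> assume "\<phi> \<in> character_group (cyclic_product k)"
  then have \<phi>: "\<phi> \<in> extensional ?G" "\<And>y. y \<in> ?G \<Longrightarrow> \<phi> y \<noteq> 0"
    "\<And>x y. x \<in> ?G \<Longrightarrow> y \<in> ?G \<Longrightarrow> \<phi> (x \<otimes>\<^bsub>cyclic_product k\<^esub> y) = \<phi> x * \<phi> y"
    by (auto simp: character_group_def hom_def Pi_def)
  obtain \<alpha> where \<alpha>: "\<alpha> \<in> char_indices k" "fourier_coeff k \<phi> \<alpha> \<noteq> 0"
    using fourier_expansion[OF k G.one_closed, of \<phi>] \<phi>(2)[OF G.one_closed]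
    by (metis (no_types, lifting) mult_zero_left sum.neutral)
  define c where "c = (\<Sum>z\<in>?G. \<phi> z * cnj (chi k \<alpha> z))"
  have c: "c \<noteq> 0" using \<alpha>(2) by (auto simp: fourier_coeff_def c_def)
  have "\<phi> y = chi k \<alpha> y" if y: "y \<in> ?G" for y
  proof -
    have "c = (\<Sum>z\<in>?G. \<phi> (z \<otimes>\<^bsub>cyclic_product k\<^esub> y) * cnj (chi k \<alpha> (z \<otimes>\<^bsub>cyclic_product k\<^esub> y)))"
      unfolding c_def using y
      by (intro sum.reindex_bij_witness[of _ "\<lambda>z. z \<otimes>\<^bsub>cyclic_product k\<^esub> y"
            "\<lambda>z. z \<otimes>\<^bsub>cyclic_product k\<^esub> inv\<^bsub>cyclic_product k\<^esub> y"])
         (auto simp: G.m_assoc)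
    also have "\<dots> = \<phi> y * cnj (chi k \<alpha> y) * c"
      unfolding c_def sum_distrib_left
      using y by (intro sum.cong refl) (simp add: \<phi>(3) chi_mult[OF k])
    finally have "\<phi> y * cnj (chi k \<alpha> y) = 1" using c by simp
    then show ?thesis using chi_norm[OF y, of \<alpha>]
      by (metis mult.commute mult.left_commute mult_1)
  qed
  moreover have "chi k \<alpha> \<in> extensional ?G" by (simp add: chi_def)
  ultimately have "\<phi> = chi k \<alpha>" using \<phi>(1) by (metis extensionalityI)
  then show "\<phi> \<in> chi k ` char_indices k" using \<alpha>(1) by blast
qed

lemma inj_on_chi:
  assumes k: "\<forall>i. k i > 0"
  shows "inj_on (chi k) (char_indices k)"
proof (rule inj_onI, rule ccontr)
  fix \<alpha> \<beta> assume "\<alpha> \<in> char_indices k" "\<beta> \<in> char_indices k" "chi k \<alpha> = chi k \<beta>" "\<alpha> \<noteq> \<beta>"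
  then show False
    using chi_orthogonal'[OF k, of \<alpha> \<beta>] chi_orthogonal'[OF k, of \<beta> \<beta>] card_carrier_pos[OF k]
    by simp
qed

end

theory Submission
  imports Defs
begin

text \<open>
  A class modulo the torus ideal is a Laurent polynomial, and it is determined by its Laurent
  coefficients (\<open>torus_cong_0I\<close>). Restricting to \<open>G\<close> means evaluating at the grid of points whose
  \<open>i\<close>-th coordinate is a \<open>k i\<close>-th root of unity. On this grid \<open>x i\<close> to the power \<open>k i\<close> is \<open>1\<close>, so in
  general only the exponents modulo \<open>k i\<close> are visible there. But if all exponents of \<open>x i\<close> lie
  strictly between \<open>- k i / 2\<close> and \<open>k i / 2\<close>, then two different ones are never congruent modulo
  \<open>k i\<close>, and the orthogonality of the characters recovers every coefficient from the values on the
  grid. Hence a Laurent polynomial with such exponents that vanishes on the grid is zero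
  (\<open>torus_cong_0_if_restriction_0\<close>).

  The theorem is this uniqueness principle applied to the difference of \<open>f\<close> and the sum of Hermitian
  squares of the lifts. The difference vanishes on the grid: evaluation at a point of the torus is
  multiplicative and turns \<open>conj_poly\<close> into complex conjugation, a lift restricts to the function
  it came from (\<open>restriction_lift\<close>), and the restriction of \<open>f\<close> is the given sum of squares. Its
  exponents are small enough: those of \<open>f\<close> are below \<open>k i / 4\<close> by the degree bound, and those of the
  lifts are below \<open>k i / 4\<close> in absolute value because \<open>tau\<close> sends both the first and the last
  quarter of the indices to such exponents, so a product of a lift and a conjugate stays below
  \<open>k i / 2\<close>.
\<close>

section \<open>Laurent exponents and Laurent coefficients\<close>

definition laurent_exp :: "'n monomial \<Rightarrow> 'n \<Rightarrow> int" where
  "laurent_exp m i = int (Poly_Mapping.lookup m (X i)) - int (Poly_Mapping.lookup m (Xbar i))"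

lemma laurent_exp_add: "laurent_exp (m + m') i = laurent_exp m i + laurent_exp m' i"
  by (simp add: laurent_exp_def lookup_add)

lemma laurent_exp_pair_mono [simp]: "laurent_exp (pair_mono j) i = 0"
  by (simp add: laurent_exp_def pair_mono_def lookup_add lookup_single when_def)

lemma laurent_exp_swap: "laurent_exp (Poly_Mapping.map_key swap_var m) i = - laurent_exp m i"
  by (simp add: laurent_exp_def map_key.rep_eq[OF inj_swap_var])

definition laurent_coeff :: "('n \<Rightarrow> int) \<Rightarrow> 'n torus_poly \<Rightarrow> complex" where
  "laurent_coeff e p = wsum (\<lambda>m. if laurent_exp m = e then 1 else 0) p"

text \<open>
  Multiplying a monomial by \<open>x i\<close> times \<open>x i\<close>-bar leaves its Laurent exponent alone, so reading off
  a Laurent coefficient is a functional on the quotient by the torus ideal.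
\<close>

lemma laurent_coeff_cong:
  assumes "torus_cong p q"
  shows "laurent_coeff e p = laurent_coeff e q"
proof -
  have "laurent_coeff e (p - q) = 0"
    using assms unfolding torus_cong_def laurent_coeff_def
    by (intro wsum_ideal) (auto simp: fun_eq_iff laurent_exp_add)
  then show ?thesis by (simp add: laurent_coeff_def wsum_diff)
qed

text \<open>
  In a reduced monomial one of the exponents of \<open>x i\<close> and \<open>x i\<close>-bar is zero, so their difference
  determines both.
\<close>

lemma reduced_monomial_eqI:
  fixes r :: "'n torus_poly"
  assumes "reduced r" "m \<in> Poly_Mapping.keys r" "m' \<in> Poly_Mapping.keys r"
    and "laurent_exp m = laurent_exp m'"
  shows "m = m'"
proof (rule poly_mapping_eqI)
  fix v :: "'n torus_var"
  obtain i where v: "v = X i \<or> v = Xbar i" by (cases v) auto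
  have "laurent_exp m i = laurent_exp m' i" using assms(4) by simp
  then show "Poly_Mapping.lookup m v = Poly_Mapping.lookup m' v"
    using bspec[OF assms(1)[unfolded reduced_def] assms(2), rule_format, of i]
      bspec[OF assms(1)[unfolded reduced_def] assms(3), rule_format, of i] v
    by (auto simp: laurent_exp_def)
qed

lemma laurent_coeff_reduced:
  assumes "reduced r" "m \<in> Poly_Mapping.keys r"
  shows "laurent_coeff (laurent_exp m) r = Poly_Mapping.lookup r m"
proof -
  have "laurent_coeff (laurent_exp m) r =
      (\<Sum>m' \<in> Poly_Mapping.keys r. if m' = m then Poly_Mapping.lookup r m' else 0)"
    unfolding laurent_coeff_def wsum_def
    using reduced_monomial_eqI[OF assms(1) _ assms(2)] by (intro sum.cong) auto
  then show ?thesis using assms(2) by simp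
qed

text \<open>
  The coefficients of the reduced representative are Laurent coefficients, so if these all vanish,
  the representative is zero.
\<close>

lemma torus_cong_0I:
  fixes p :: "'n::finite torus_poly"
  assumes "\<And>e. laurent_coeff e p = 0"
  shows "torus_cong p 0"
proof -
  have "Poly_Mapping.keys (torus_rep p) = {}"
    using laurent_coeff_reduced[OF torus_rep(1), of _ p]
      laurent_coeff_cong[OF torus_rep(2), of _ p] assms
    by (metis all_not_in_conv in_keys_iff)
  then show ?thesis using torus_rep(2)[of p] by simp
qed

text \<open>
  The bound concerns the reduced representative, the one that defines the degree; the monomials of
  \<open>f\<close> itself may have larger Laurent exponents that cancel.
\<close>

lemma laurent_exp_le_torus_deg:
  fixes f :: "'n::finite torus_poly"
  assumes "m \<in> Poly_Mapping.keys (torus_rep f)"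
  shows "\<bar>laurent_exp m i\<bar> \<le> int (torus_deg i f)"
proof -
  have "max (Poly_Mapping.lookup m (X i)) (Poly_Mapping.lookup m (Xbar i)) \<le> torus_deg i f"
    unfolding torus_deg_def using assms by (intro Max_ge) auto
  then show ?thesis by (auto simp: laurent_exp_def)
qed


section \<open>Evaluation at a point of the torus\<close>

lemma wsum_sum: "wsum w (\<Sum>a\<in>A. p a) = (\<Sum>a\<in>A. wsum w (p a))"
  by (induction A rule: infinite_finite_induct) (simp_all add: wsum_zero wsum_add)

lemma wsum_mult:
  assumes "\<And>m m'. w (m + m') = w m * w m'"
  shows "wsum w (p * q) = wsum w p * wsum w q"
proof (induction p rule: torus_poly_induct)
  case zero
  show ?case by (simp add: wsum_zero)
next
  case (add p m c)
  have "wsum w (Poly_Mapping.single m c * q) = c * w m * wsum w q"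
  proof (induction q rule: torus_poly_induct)
    case zero
    show ?case by (simp add: wsum_zero)
  next
    case (add q m' c')
    then show ?case
      by (simp add: distrib_left wsum_add mult_single wsum_single assms algebra_simps)
  qed
  with add show ?case by (simp add: distrib_right wsum_add wsum_single)
qed

text \<open>
  \<open>x i\<close>-bar is evaluated at the inverse of \<open>z i\<close>, so that points with nonzero coordinates give ring
  homomorphisms that vanish on the torus ideal.
\<close>

definition torus_eval :: "('n::finite \<Rightarrow> complex) \<Rightarrow> 'n torus_poly \<Rightarrow> complex" where
  "torus_eval z = wsum (\<lambda>m. \<Prod>i\<in>UNIV. z i powi laurent_exp m i)"

lemma torus_eval_mult:
  assumes "\<And>i. z i \<noteq> 0"
  shows "torus_eval z (p * q) = torus_eval z p * torus_eval z q"
  unfolding torus_eval_def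
  by (rule wsum_mult)
     (simp add: laurent_exp_add power_int_add assms prod.distrib)

text \<open>
  On the unit circle the conjugate of \<open>z i\<close> is its inverse, which is what exchanging \<open>x i\<close> and
  \<open>x i\<close>-bar produces.
\<close>

lemma torus_eval_conj_poly:
  assumes "\<And>i. cmod (z i) = 1"
  shows "torus_eval z (conj_poly p) = cnj (torus_eval z p)"
proof -
  have "cnj (z i) = inverse (z i)" for i
    using assms[of i] complex_norm_square[of "z i"] by (intro inverse_unique [symmetric]) simp
  then show ?thesis
    by (simp add: torus_eval_def conj_poly_def wsum_sum wsum_single laurent_exp_swap
        wsum_def[of _ p] power_int_minus power_int_inverse)
qed

definition grid_point :: "('n \<Rightarrow> nat) \<Rightarrow> ('n \<Rightarrow> int) \<Rightarrow> 'n \<Rightarrow> complex" where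
  "grid_point k y i = cis (2 * pi * of_int (y i) / of_nat (k i))"

lemma grid_point_powi:
  "grid_point k y i powi a = exp (2 * of_real pi * \<i> * of_int a * of_int (y i) / of_nat (k i))"
proof -
  have "of_int a * (2 * pi * of_int (y i) / of_nat (k i)) = 2 * pi * of_int a * of_int (y i) / of_nat (k i)"
    by simp
  then show ?thesis
    by (simp only: grid_point_def cis_power_int) (simp add: cis_conv_exp mult_ac)
qed

lemma restriction_eq_torus_eval: "restriction k p y = torus_eval (grid_point k y) p"
  by (simp add: restriction_def torus_eval_def wsum_def grid_point_powi laurent_exp_def)

lemma restriction_sum: "restriction k (\<Sum>a\<in>A. p a) y = (\<Sum>a\<in>A. restriction k (p a) y)"
  by (simp add: restriction_eq_torus_eval torus_eval_def wsum_sum)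

lemma restriction_diff: "restriction k (p - q) y = restriction k p y - restriction k q y"
  by (simp add: restriction_eq_torus_eval torus_eval_def wsum_diff)

lemma chi_eq_grid_point:
  assumes "y \<in> carrier (cyclic_product k)"
  shows "chi k \<alpha> y = (\<Prod>i\<in>UNIV. grid_point k y i powi int (\<alpha> i))"
  unfolding grid_point_powi using assms by (simp add: chi_def)


section \<open>Recovering Laurent coefficients from values on the grid\<close>

text \<open>
  The sum factors over the coordinates into sums of powers of roots of unity. The bound on \<open>d\<close> excludes
  the nonzero multiples of \<open>k i\<close>, for which these would not vanish.
\<close>

lemma sum_grid_point:
  fixes k :: "'n::finite \<Rightarrow> nat"
  assumes k: "\<forall>i. k i > 0" and d: "\<And>i. \<bar>d i\<bar> < int (k i)"
  shows "(\<Sum>y\<in>carrier (cyclic_product k). \<Prod>i\<in>UNIV. grid_point k y i powi d i) =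
    (if d = (\<lambda>_. 0) then of_nat (card (carrier (cyclic_product k))) else 0)"
proof -
  have "(\<Sum>y\<in>carrier (cyclic_product k). \<Prod>i\<in>UNIV. grid_point k y i powi d i) =
      (\<Sum>y\<in>carrier (cyclic_product k). \<Prod>i\<in>UNIV.
        exp (2 * of_real pi * \<i> * of_int (y i) * of_int (d i) / of_nat (k i)))"
    by (simp add: grid_point_powi mult_ac)
  also have "\<dots> = (\<Prod>i\<in>UNIV. \<Sum>a\<in>{0..<int (k i)}.
        exp (2 * of_real pi * \<i> * of_int a * of_int (d i) / of_nat (k i)))"
    unfolding carrier_cyclic_product[OF k] by (rule prod_sum_PiE [symmetric]) auto
  also have "\<dots> = (\<Prod>i\<in>UNIV. if d i = 0 then of_nat (k i) else 0)"
    using k d by (intro prod.cong) (simp_all only: root_sum_int)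
  finally show ?thesis
    by (simp add: prod_if_all card_carrier_cyclic_product[OF k] fun_eq_iff del: of_nat_prod)
qed

text \<open>
  Fourier inversion on the grid: since the exponents of \<open>p\<close> and \<open>e\<close> are below half of \<open>k i\<close>, they
  differ by less than \<open>k i\<close>, so summation against the character of exponent \<open>- e\<close> kills every monomial
  except those of Laurent exponent \<open>e\<close>.
\<close>

lemma laurent_coeff_from_restriction:
  fixes p :: "'n::finite torus_poly"
  assumes k: "\<forall>i. k i > 0"
    and p: "\<And>m i. m \<in> Poly_Mapping.keys p \<Longrightarrow> 2 * \<bar>laurent_exp m i\<bar> < int (k i)"
    and e: "\<And>i. 2 * \<bar>e i\<bar> < int (k i)"
  shows "(\<Sum>y\<in>carrier (cyclic_product k).
      restriction k p y * (\<Prod>i\<in>UNIV. grid_point k y i powi (- e i))) =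
    laurent_coeff e p * of_nat (card (carrier (cyclic_product k)))"
proof -
  let ?G = "carrier (cyclic_product k)"
  have nz: "grid_point k y i \<noteq> 0" for y i by (simp add: grid_point_def)
  have "(\<Sum>y\<in>?G. restriction k p y * (\<Prod>i\<in>UNIV. grid_point k y i powi (- e i))) =
      (\<Sum>y\<in>?G. \<Sum>m\<in>Poly_Mapping.keys p. Poly_Mapping.lookup p m *
        (\<Prod>i\<in>UNIV. grid_point k y i powi (laurent_exp m i - e i)))"
    by (simp add: restriction_eq_torus_eval torus_eval_def wsum_def sum_distrib_right mult.assoc
        prod.distrib [symmetric] power_int_add [symmetric] nz)
  also have "\<dots> = (\<Sum>m\<in>Poly_Mapping.keys p. Poly_Mapping.lookup p m *
      (\<Sum>y\<in>?G. \<Prod>i\<in>UNIV. grid_point k y i powi (laurent_exp m i - e i)))"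
    by (subst sum.swap) (simp add: sum_distrib_left)
  also have "\<dots> = (\<Sum>m\<in>Poly_Mapping.keys p. Poly_Mapping.lookup p m *
      (if laurent_exp m = e then of_nat (card ?G) else 0))"
  proof (intro sum.cong refl arg_cong2[where f = "(*)"])
    fix m assume m: "m \<in> Poly_Mapping.keys p"
    have "\<bar>laurent_exp m i - e i\<bar> < int (k i)" for i
      using p[OF m, of i] e[of i] by linarith
    from sum_grid_point[OF k this]
    show "(\<Sum>y\<in>?G. \<Prod>i\<in>UNIV. grid_point k y i powi (laurent_exp m i - e i)) =
        (if laurent_exp m = e then of_nat (card ?G) else 0)"
      by (simp add: fun_eq_iff)
  qed
  also have "\<dots> = laurent_coeff e p * of_nat (card ?G)"
    unfolding laurent_coeff_def wsum_def sum_distrib_right by (intro sum.cong) auto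
  finally show ?thesis .
qed

lemma torus_cong_0_if_restriction_0:
  fixes p :: "'n::finite torus_poly"
  assumes k: "\<forall>i. k i > 0"
    and p: "\<And>m i. m \<in> Poly_Mapping.keys p \<Longrightarrow> 2 * \<bar>laurent_exp m i\<bar> < int (k i)"
    and 0: "\<And>y. y \<in> carrier (cyclic_product k) \<Longrightarrow> restriction k p y = 0"
  shows "torus_cong p 0"
proof (rule torus_cong_0I)
  fix e :: "'n \<Rightarrow> int"
  show "laurent_coeff e p = 0"
  proof (cases "\<forall>i. 2 * \<bar>e i\<bar> < int (k i)")
    case True
    have "laurent_coeff e p * of_nat (card (carrier (cyclic_product k))) = 0"
      by (subst laurent_coeff_from_restriction [symmetric]) (use k p 0 True in auto)
    then show ?thesis using card_carrier_pos[OF k] by simp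
  next
    case False
    then show ?thesis using p by (auto simp: laurent_coeff_def wsum_def intro!: sum.neutral)
  qed
qed


section \<open>Lifts\<close>

text \<open>The reduced monomial with a prescribed Laurent exponent: of \<open>nat (e i)\<close> and \<open>nat (- e i)\<close> at most one
  is nonzero.\<close>

definition laurent_monomial :: "('n::finite \<Rightarrow> int) \<Rightarrow> 'n monomial" where
  "laurent_monomial e = (\<Sum>i\<in>UNIV.
     Poly_Mapping.single (X i) (nat (e i)) + Poly_Mapping.single (Xbar i) (nat (- e i)))"

lemma laurent_exp_laurent_monomial [simp]: "laurent_exp (laurent_monomial e) i = e i"
  by (simp add: laurent_exp_def laurent_monomial_def lookup_sum lookup_add lookup_single when_def)

lemma var_pow: "var v ^ n = Poly_Mapping.single (Poly_Mapping.single v n) 1"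
  by (induction n) (simp_all add: var_def mult_single single_add [symmetric] flip: single_one)

lemma var_power_eq:
  "var_power i e = Poly_Mapping.single
     (Poly_Mapping.single (X i) (nat e) + Poly_Mapping.single (Xbar i) (nat (- e))) 1"
  by (simp add: var_power_def var_pow)

lemma prod_single_1:
  "(\<Prod>a\<in>A. Poly_Mapping.single (m a) (1 :: complex)) = Poly_Mapping.single (\<Sum>a\<in>A. m a) 1"
  by (induction A rule: infinite_finite_induct) (simp_all add: mult_single)

lemma lift_eq:
  "lift k g = (\<Sum>\<alpha>\<in>char_indices k.
     Poly_Mapping.single (laurent_monomial (\<lambda>i. tau (k i) (\<alpha> i))) (fourier_coeff k g \<alpha>))"
  by (simp add: lift_def const_def var_power_eq prod_single_1 laurent_monomial_def mult_single)

lemma keys_lift: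
  assumes "m \<in> Poly_Mapping.keys (lift k g)"
  obtains \<alpha> where "\<alpha> \<in> char_indices k" "fourier_coeff k g \<alpha> \<noteq> 0"
    "laurent_exp m = (\<lambda>i. tau (k i) (\<alpha> i))"
proof -
  let ?t = "\<lambda>\<alpha>. Poly_Mapping.single (laurent_monomial (\<lambda>i. tau (k i) (\<alpha> i)))
    (fourier_coeff k g \<alpha>)"
  obtain \<alpha> where \<alpha>: "\<alpha> \<in> char_indices k" "m \<in> Poly_Mapping.keys (?t \<alpha>)"
    using subsetD[OF keys_sum[of ?t "char_indices k"], of m] assms unfolding lift_eq by blast
  then have "fourier_coeff k g \<alpha> \<noteq> 0" "m = laurent_monomial (\<lambda>i. tau (k i) (\<alpha> i))"
    by (simp_all split: if_splits)
  with \<alpha>(1) show ?thesis using that[of \<alpha>] by (simp add: fun_eq_iff)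
qed

text \<open>\<open>tau\<close> changes an index by a multiple of \<open>k i\<close>, which a \<open>k i\<close>-th root of unity does not see.\<close>

lemma grid_point_powi_tau:
  assumes "k i > 0"
  shows "grid_point k y i powi tau (k i) a = grid_point k y i powi int a"
proof -
  have nz: "grid_point k y i \<noteq> 0" by (simp add: grid_point_def)
  have "grid_point k y i powi int (k i) = cis (2 * pi * of_int (y i))"
    using assms by (simp add: grid_point_def Complex.DeMoivre)
  also have "\<dots> = 1" by (rule cis_multiple_2pi) simp
  finally show ?thesis using nz by (simp add: tau_def power_int_diff)
qed

text \<open>
  Replacing each \<open>\<alpha> i\<close> by \<open>tau (k i) (\<alpha> i)\<close> does not change values on the grid, so the lift takes there
  the values of the Fourier expansion of \<open>g\<close>.
\<close>

lemma restriction_lift: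
  fixes k :: "'n::finite \<Rightarrow> nat"
  assumes k: "\<forall>i. k i > 0" and y: "y \<in> carrier (cyclic_product k)"
  shows "restriction k (lift k g) y = g y"
  using k by (simp add: fourier_expansion[OF k y, of g] restriction_eq_torus_eval torus_eval_def
      lift_eq wsum_sum wsum_single grid_point_powi_tau chi_eq_grid_point[OF y])

lemma restriction_mult_conj_poly:
  "restriction k (p * conj_poly p) y = of_real ((cmod (restriction k p y))\<^sup>2)"
proof -
  have 1: "cmod (grid_point k y i) = 1" and nz: "grid_point k y i \<noteq> 0" for i
    by (simp_all add: grid_point_def)
  show ?thesis
    by (simp only: restriction_eq_torus_eval torus_eval_mult[of "grid_point k y", OF nz]
        torus_eval_conj_poly[of "grid_point k y", OF 1] complex_norm_square)
qed

text \<open>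
  The Laurent exponents of \<open>p * conj_poly p\<close> are differences of two exponents of \<open>p\<close>, hence the loss
  of a factor two. This is why a quarter of \<open>k i\<close> is the right bound for the lifts.
\<close>

lemma keys_mult_conj_poly:
  fixes p :: "'n torus_poly" and b :: "'n \<Rightarrow> int"
  assumes p: "\<And>m i. m \<in> Poly_Mapping.keys p \<Longrightarrow> 4 * \<bar>laurent_exp m i\<bar> < b i"
    and m: "m \<in> Poly_Mapping.keys (p * conj_poly p)"
  shows "2 * \<bar>laurent_exp m i\<bar> < b i"
proof -
  obtain m1 m2 where m12: "m = m1 + m2" "m1 \<in> Poly_Mapping.keys p"
      "m2 \<in> Poly_Mapping.keys (conj_poly p)"
    using m keys_mult[of p "conj_poly p"] by auto
  let ?t = "\<lambda>n. Poly_Mapping.single (Poly_Mapping.map_key swap_var n) (cnj (Poly_Mapping.lookup p n))"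
  obtain n where n: "n \<in> Poly_Mapping.keys p" "m2 \<in> Poly_Mapping.keys (?t n)"
    using subsetD[OF keys_sum[of ?t "Poly_Mapping.keys p"], of m2] m12(3)
    unfolding conj_poly_def by blast
  then have "m2 = Poly_Mapping.map_key swap_var n"
    by (simp split: if_splits)
  then have "laurent_exp m i = laurent_exp m1 i - laurent_exp n i"
    by (simp add: m12(1) laurent_exp_add laurent_exp_swap)
  then show ?thesis
    using p[OF m12(2), of i] p[OF n(1), of i] by linarith
qed

lemma tau_quarter:
  assumes "real a < real k / 4 \<or> real a \<le> real k \<and> real a > 3 * real k / 4" "a < k"
  shows "4 * \<bar>tau k a\<bar> < int k"
  using assms by (auto simp: tau_def)

theorem theorem6p4:
  fixes f :: "'n::finite torus_poly"
    and k :: "'n \<Rightarrow> nat"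
    and S :: "(('n \<Rightarrow> int) \<Rightarrow> complex) set"
    and m :: nat
    and h :: "nat \<Rightarrow> ('n \<Rightarrow> int) \<Rightarrow> complex"
  assumes "S \<subseteq> character_group (cyclic_product k)"
    and "\<forall>i. k i > 4 * torus_deg i f"
    and "\<forall>y \<in> carrier (cyclic_product k).
           restriction k f y = (\<Sum>j = 1..m. of_real ((cmod (h j y))\<^sup>2))"
    and "(\<Union>j \<in> {1..m}. fourier_supp k (h j)) \<subseteq> S"
    and "\<forall>\<alpha> \<in> char_indices k. chi k \<alpha> \<in> S \<longrightarrow>
           (\<forall>i. (0 \<le> real (\<alpha> i) \<and> real (\<alpha> i) < real (k i) / 4) \<or>
                (real (k i) \<ge> real (\<alpha> i) \<and> real (\<alpha> i) > 3 * real (k i) / 4))"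
  shows "torus_cong f (\<Sum>j = 1..m. lift k (h j) * conj_poly (lift k (h j)))"
proof -
  let ?s = "\<Sum>j = 1..m. lift k (h j) * conj_poly (lift k (h j))"
  have k: "\<forall>i. k i > 0" using assms(2) by (metis gr_zeroI not_less_zero)
  have lift_keys: "4 * \<bar>laurent_exp n i\<bar> < int (k i)"
    if j: "j \<in> {1..m}" and n: "n \<in> Poly_Mapping.keys (lift k (h j))" for j n i
  proof -
    from n obtain \<alpha> where \<alpha>: "\<alpha> \<in> char_indices k" "fourier_coeff k (h j) \<alpha> \<noteq> 0"
      "laurent_exp n = (\<lambda>i. tau (k i) (\<alpha> i))"
      by (rule keys_lift)
    have "chi k \<alpha> \<in> S" using assms(4) j \<alpha>(1,2) by (force simp: fourier_supp_def)
    moreover have "\<alpha> i < k i" using \<alpha>(1) by (simp add: char_indices_def)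
    ultimately show ?thesis using assms(5) \<alpha>(1) tau_quarter[of "\<alpha> i" "k i"] by (auto simp: \<alpha>(3))
  qed
  \<comment> \<open>The reduced representative replaces \<open>f\<close> because only its monomials obey the degree bound.\<close>
  have "torus_cong (torus_rep f - ?s) 0"
  proof (rule torus_cong_0_if_restriction_0[OF k])
    fix n i assume "n \<in> Poly_Mapping.keys (torus_rep f - ?s)"
    then have "n \<in> Poly_Mapping.keys (torus_rep f) \<or> n \<in> Poly_Mapping.keys ?s"
      using keys_diff[of "torus_rep f" ?s] by auto
    then show "2 * \<bar>laurent_exp n i\<bar> < int (k i)"
    proof
      assume "n \<in> Poly_Mapping.keys (torus_rep f)"
      then show ?thesis
        using laurent_exp_le_torus_deg[of n f i] assms(2)[rule_format, of i] by linarith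
    next
      assume "n \<in> Poly_Mapping.keys ?s"
      then obtain j where j: "j \<in> {1..m}"
          "n \<in> Poly_Mapping.keys (lift k (h j) * conj_poly (lift k (h j)))"
        using keys_sum[of "\<lambda>j. lift k (h j) * conj_poly (lift k (h j))" "{1..m}"] by blast
      from lift_keys[OF j(1)] j(2) show ?thesis by (rule keys_mult_conj_poly)
    qed
  next
    fix y assume y: "y \<in> carrier (cyclic_product k)"
    have "restriction k ?s y = restriction k f y"
      using assms(3) y
      by (simp add: restriction_sum restriction_mult_conj_poly restriction_lift[OF k y])
    then show "restriction k (torus_rep f - ?s) y = 0"
      using restriction_cong[OF torus_rep(2)[of f], of k y]
      by (simp add: restriction_diff)
  qed
  then have "torus_cong (torus_rep f) ?s" by (simp add: torus_cong_def)
  with torus_rep(2) show ?thesis by (rule torus_cong_trans)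
qed

end
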